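(* Let $d \ge 1$, $r$ and $N \ge 1$ be integers with $2 \le r \le d+1$. Then there exists a family of $N$ color classes $X_1,\ldots,X_N$, each consisting of $r$ points in $\mathbb{R}^d$, such that for every colorful partition $A_1,\ldots,A_r$ of $X_1\cup\cdots\cup X_N$ there is a set of at most $p_r N$ color classes whose removal breaks the partition, i.e. after deleting from every $A_i$ all points of these color classes, the convex hulls of the $r$ remaining parts have empty intersection.
   Context: A color class is a set of points of $\mathbb{R}^d$ all of the same color; different color classes are disjoint. Given $N$ color classes of $r$ points each, a colorful partition of their union is a partition into $r$ parts $A_1,\ldots,A_r$ such that each part contains exactly one point of each color class. A partition is a Tverberg partition if the convex hulls of its parts have a common point. Removing a color class means deleting all of its points from all parts. For a positive integer $r$, $p_r$ denotes the probability that a uniformly random permutation of $\{1,\ldots,r\}$ has at least one fixed point. *)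

theory Defs
  imports "HOL-Analysis.Analysis" "HOL-Probability.Probability" "HOL-Combinatorics.Permutations"
begin

definition color_classes :: "nat \<Rightarrow> nat \<Rightarrow> (nat \<Rightarrow> 'a set) \<Rightarrow> bool" where
  "color_classes N r X \<longleftrightarrow>
     (\<forall>i\<in>{1..N}. finite (X i) \<and> card (X i) = r) \<and> disjoint_family_on X {1..N}"

definition colorful_partition :: "nat \<Rightarrow> nat \<Rightarrow> (nat \<Rightarrow> 'a set) \<Rightarrow> (nat \<Rightarrow> 'a set) \<Rightarrow> bool" where
  "colorful_partition N r X A \<longleftrightarrow>
     disjoint_family_on A {1..r} \<and>
     (\<Union>j\<in>{1..r}. A j) = (\<Union>i\<in>{1..N}. X i) \<and>
     (\<forall>j\<in>{1..r}. \<forall>i\<in>{1..N}. card (A j \<inter> X i) = 1)"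

text \<open>The parts of \<open>A\<close> with index in \<open>{1..r}\<close> have convex hulls with a common point;
  that they partition a given set is a separate condition.\<close>

definition hulls_intersect :: "nat \<Rightarrow> (nat \<Rightarrow> 'a::real_vector set) \<Rightarrow> bool" where
  "hulls_intersect r A \<longleftrightarrow> (\<Inter>j\<in>{1..r}. convex hull (A j)) \<noteq> {}"

text \<open>Color classes are removed by giving the set \<open>S\<close> of their indices.\<close>

definition remove_classes :: "(nat \<Rightarrow> 'a set) \<Rightarrow> nat set \<Rightarrow> (nat \<Rightarrow> 'a set) \<Rightarrow> nat \<Rightarrow> 'a set" where
  "remove_classes X S A j = A j - (\<Union>i\<in>S. X i)"

definition fixed_point_prob :: "nat \<Rightarrow> real" where
  "fixed_point_prob r =
     measure_pmf.prob (pmf_of_set {\<pi>. \<pi> permutes {1..r}}) {\<pi>. \<exists>i\<in>{1..r}. \<pi> i = i}"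

end

theory Submission imports Defs begin

text \<open>
  Take \<open>r\<close> closed half-spaces \<open>H\<^sub>1, \<dots>, H\<^sub>r\<close> with empty intersection such that a whole ray,
  apart from an initial segment, avoids \<open>H\<^sub>k\<close> while lying in all the others; the class \<open>X\<^sub>i\<close>
  consists of one point on each of the \<open>r\<close> rays. A colorful partition induces on each class a
  permutation \<open>\<pi>\<^sub>i\<close>, where \<open>\<pi>\<^sub>i(j)\<close> is the ray of the point of \<open>X\<^sub>i\<close> in \<open>A\<^sub>j\<close>. If \<open>\<sigma>\<close> is a uniformly
  random permutation, the expected number of classes for which \<open>\<pi>\<^sub>i\<close> and \<open>\<sigma>\<close> agree somewhere is
  \<open>p\<^sub>r N\<close>, so some \<open>\<sigma>\<close> achieves at most this number. After removing these classes, \<open>A\<^sub>j\<close> contains no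
  point of ray \<open>\<sigma>(j)\<close>, hence it lies in the half-space \<open>H\<^bsub>\<sigma>(j)\<^esub>\<close>.
\<close>

lemma fixed_point_prob_eq_card:
  "fixed_point_prob r =
     real (card {\<pi>. \<pi> permutes {1..r} \<and> (\<exists>i\<in>{1..r}. \<pi> i = i)}) / fact r"
proof -
  let ?P = "{\<pi>. \<pi> permutes {1..r}}"
  have "finite ?P" "?P \<noteq> {}"
    using permutes_id by (blast intro: finite_permutations finite_atLeastAtMost)+
  then show ?thesis
    unfolding fixed_point_prob_def
    by (simp add: measure_pmf_of_set card_permutations Int_def)
qed

text \<open>Composing with \<open>inv \<pi>\<close> on the left turns the places where
  \<open>\<sigma>\<close> agrees with \<open>\<pi>\<close> into fixed points, so the count does not
  depend on \<open>\<pi>\<close>.\<close>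

lemma card_permutations_agreeing_somewhere:
  assumes "\<pi> permutes S"
  shows "card {\<sigma>. \<sigma> permutes S \<and> (\<exists>j\<in>S. \<pi> j = \<sigma> j)} =
    card {\<tau>. \<tau> permutes S \<and> (\<exists>j\<in>S. \<tau> j = j)}"
proof (rule bij_betw_same_card[of "\<lambda>\<sigma>. inv \<pi> \<circ> \<sigma>"], rule bij_betw_byWitness[of _ "\<lambda>\<tau>. \<pi> \<circ> \<tau>"])
  let ?A = "{\<sigma>. \<sigma> permutes S \<and> (\<exists>j\<in>S. \<pi> j = \<sigma> j)}"
  let ?F = "{\<tau>. \<tau> permutes S \<and> (\<exists>j\<in>S. \<tau> j = j)}"
  show "\<forall>\<sigma>\<in>?A. \<pi> \<circ> (inv \<pi> \<circ> \<sigma>) = \<sigma>" "\<forall>\<tau>\<in>?F. inv \<pi> \<circ> (\<pi> \<circ> \<tau>) = \<tau>"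
    using permutes_inverses[OF assms] by (auto simp: fun_eq_iff)
  show "(\<lambda>\<sigma>. inv \<pi> \<circ> \<sigma>) ` ?A \<subseteq> ?F"
    using assms by (auto intro!: permutes_compose permutes_inv simp: permutes_inv_eq)
  show "(\<lambda>\<tau>. \<pi> \<circ> \<tau>) ` ?F \<subseteq> ?A"
    using assms by (force intro!: permutes_compose)
qed

text \<open>First-moment argument: double counting the pairs of an index and a permutation that
  agree somewhere shows that the average over all \<open>\<sigma>\<close> equals the bound, and some
  \<open>\<sigma>\<close> is not above average.\<close>

lemma ex_permutation_few_agreements:
  fixes \<pi> :: "'i \<Rightarrow> nat \<Rightarrow> nat"
  assumes "finite I" and \<pi>: "\<And>i. i \<in> I \<Longrightarrow> \<pi> i permutes {1..r}"
  obtains \<sigma> where "\<sigma> permutes {1..r}"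
    and "real (card {i\<in>I. \<exists>j\<in>{1..r}. \<pi> i j = \<sigma> j}) \<le> fixed_point_prob r * real (card I)"
proof -
  let ?P = "{\<sigma>. \<sigma> permutes {1..r}}"
  let ?bad = "\<lambda>\<sigma>. card {i\<in>I. \<exists>j\<in>{1..r}. \<pi> i j = \<sigma> j}"
  let ?p = "fixed_point_prob r"
  have fin: "finite ?P" and ne: "?P \<noteq> {}"
    using permutes_id by (blast intro: finite_permutations finite_atLeastAtMost)+
  have "(\<Sum>\<sigma>\<in>?P. ?bad \<sigma>) = (\<Sum>i\<in>I. card {\<sigma>\<in>?P. \<exists>j\<in>{1..r}. \<pi> i j = \<sigma> j})"
    by (rule sum_multicount_gen) (use fin assms in auto)
  also have "\<dots> = card I * card {\<tau>. \<tau> permutes {1..r} \<and> (\<exists>j\<in>{1..r}. \<tau> j = j)}"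
    using card_permutations_agreeing_somewhere[OF \<pi>] by simp
  finally have total: "real (\<Sum>\<sigma>\<in>?P. ?bad \<sigma>) = (\<Sum>\<sigma>\<in>?P. ?p * real (card I))"
    by (simp add: fixed_point_prob_eq_card card_permutations)
  have "\<exists>\<sigma>\<in>?P. real (?bad \<sigma>) \<le> ?p * real (card I)"
  proof (rule ccontr)
    assume "\<not> ?thesis"
    then have "(\<Sum>\<sigma>\<in>?P. ?p * real (card I)) < (\<Sum>\<sigma>\<in>?P. real (?bad \<sigma>))"
      using fin ne by (intro sum_strict_mono) auto
    with total show False by simp
  qed
  with that show thesis by blast
qed

text \<open>The half-space with index \<open>k\<close> consists of the \<open>z\<close> with
  \<open>f k \<bullet> z \<le> c k\<close>. The bound on \<open>r\<close> provides
  \<open>r - 1\<close> orthonormal vectors. Unit norms serve to keep the color classes disjoint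
  later.\<close>

lemma ex_halfspaces_and_rays:
  assumes "2 \<le> r" and "r \<le> DIM('a::euclidean_space) + 1"
  obtains p f :: "nat \<Rightarrow> 'a::euclidean_space" and c :: "nat \<Rightarrow> real"
  where "inj_on p {1..r}" and "\<forall>k\<in>{1..r}. norm (p k) = 1"
    and "\<forall>t\<ge>1. \<forall>k\<in>{1..r}. \<forall>m\<in>{1..r} - {k}. f k \<bullet> (t *\<^sub>R p m) \<le> c k"
    and "\<forall>z. \<exists>k\<in>{1..r}. c k < f k \<bullet> z"
proof -
  have "card {1..<r} \<le> card (Basis :: 'a set)"
    using assms by simp
  then obtain b :: "nat \<Rightarrow> 'a" where sub: "b ` {1..<r} \<subseteq> Basis" and inj: "inj_on b {1..<r}"
    using card_le_inj[of "{1..<r}" "Basis :: 'a set"] by auto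
  have b: "b k \<bullet> b m = (if k = m then 1 else 0)" if "k \<in> {1..<r}" "m \<in> {1..<r}" for k m
    using that sub inj_onD[OF inj, of k m] inner_Basis[of "b k" "b m"] by (auto simp: image_subset_iff)
  \<comment> \<open>The last ray must lie in the half-spaces \<open>b k \<bullet> z \<le> 0\<close>
    of all \<open>k < r\<close>; the negative of a single basis vector already does, and
    \<open>b 1\<close> exists because \<open>2 \<le> r\<close>.\<close>
  define p where "p k = (if k < r then b k else - b 1)" for k
  define f where "f k = (if k < r then b k else - (\<Sum>m\<in>{1..<r}. b m))" for k
  \<comment> \<open>The value \<open>- 1\<close> makes the last half-space demand that the inner
    products with the \<open>b m\<close> sum to at least 1, which contradicts the others. It
    contains \<open>t *\<^sub>R b m\<close> only from \<open>t = 1\<close> on.\<close>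
  define c :: "nat \<Rightarrow> real" where "c k = (if k < r then 0 else - 1)" for k
  have sum_b: "(\<Sum>m\<in>{1..<r}. b m) \<bullet> b k = 1" if "k \<in> {1..<r}" for k
  proof -
    have "(\<Sum>m\<in>{1..<r}. b m) \<bullet> b k = (\<Sum>m\<in>{1..<r}. if m = k then 1 else 0)"
      using that by (auto simp: inner_sum_left b intro!: sum.cong)
    then show ?thesis using that by simp
  qed
  show thesis
  proof
    have self: "b k \<bullet> b k = 1" if "k \<in> {1..<r}" for k
      using b[OF that that] by simp
    have "norm (p k) = 1" if "k \<in> {1..r}" for k
      using that assms(1) self[of k] self[of 1] by (simp add: p_def norm_eq_1)
    then show "\<forall>k\<in>{1..r}. norm (p k) = 1" ..
    show "inj_on p {1..r}"
    proof (rule linorder_inj_onI)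
      fix k m assume *: "k < m" "k \<in> {1..r}" "m \<in> {1..r}"
      \<comment> \<open>The smaller index satisfies \<open>k < r\<close>, so the left side is 1,
        while the right side is 0 or, if \<open>m = r\<close> and \<open>k = 1\<close>, equals
        -1.\<close>
      then have "p k \<bullet> b k \<noteq> p m \<bullet> b k"
        using assms(1) b[of k k] b[of m k] b[of 1 k] by (auto simp: p_def split: if_splits)
      then show "p k \<noteq> p m" by auto
    qed auto
    have "f k \<bullet> (t *\<^sub>R p m) \<le> c k"
      if "1 \<le> t" "k \<in> {1..r}" "m \<in> {1..r}" "m \<noteq> k" for t k m
      using that assms(1) b[of k m] b[of k 1] sum_b[of m]
      by (auto simp: f_def p_def c_def)
    then show "\<forall>t\<ge>1. \<forall>k\<in>{1..r}. \<forall>m\<in>{1..r} - {k}. f k \<bullet> (t *\<^sub>R p m) \<le> c k"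
      by auto
    show "\<forall>z. \<exists>k\<in>{1..r}. c k < f k \<bullet> z"
    proof (rule allI, rule ccontr)
      fix z
      assume "\<not> (\<exists>k\<in>{1..r}. c k < f k \<bullet> z)"
      then have le: "\<And>k. k \<in> {1..r} \<Longrightarrow> f k \<bullet> z \<le> c k"
        by (auto simp: not_less)
      have "(\<Sum>m\<in>{1..<r}. b m) \<bullet> z \<le> 0"
        unfolding inner_sum_left
      proof (rule sum_nonpos)
        fix k assume "k \<in> {1..<r}"
        with le[of k] show "b k \<bullet> z \<le> 0" by (simp add: f_def c_def)
      qed
      moreover have "(\<Sum>m\<in>{1..<r}. b m) \<bullet> z \<ge> 1"
        using le[of r] assms(1) by (simp add: f_def c_def)
      ultimately show False by simp
    qed
  qed
qed

text \<open>Each part picks one point of the class, and disjointness of the parts makes this choice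
  injective, hence bijective on the finite index set.\<close>

lemma colorful_partition_permutation:
  assumes part: "colorful_partition N r X A" and i: "i \<in> {1..N}"
    and X: "X i = x ` {1..r}" and inj: "inj_on x {1..r}"
  obtains \<pi> where "\<pi> permutes {1..r}"
    and "\<And>j k. \<lbrakk>j \<in> {1..r}; k \<in> {1..r}; x k \<in> A j\<rbrakk> \<Longrightarrow> \<pi> j = k"
proof -
  have disj: "disjoint_family_on A {1..r}"
    and one: "\<And>j. j \<in> {1..r} \<Longrightarrow> card (A j \<inter> X i) = 1"
    using part i by (auto simp: colorful_partition_def)
  have "\<exists>k\<in>{1..r}. x k \<in> A j \<and> (\<forall>l\<in>{1..r}. x l \<in> A j \<longrightarrow> l = k)" if j: "j \<in> {1..r}" for j
  proof -
    obtain y where y: "A j \<inter> X i = {y}"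
      using one[OF j] by (auto simp: card_1_singleton_iff)
    then obtain k where k: "k \<in> {1..r}" "y = x k"
      using X by blast
    have "l = k" if l: "l \<in> {1..r}" "x l \<in> A j" for l
    proof -
      have "x l \<in> A j \<inter> X i" using l X by blast
      then have "x l = x k" using y k by simp
      with inj l k show ?thesis by (simp add: inj_on_eq_iff)
    qed
    with k y show ?thesis by blast
  qed
  then obtain g where g: "\<And>j. j \<in> {1..r} \<Longrightarrow>
      g j \<in> {1..r} \<and> x (g j) \<in> A j \<and> (\<forall>l\<in>{1..r}. x l \<in> A j \<longrightarrow> l = g j)"
    by metis
  define \<pi> where "\<pi> j = (if j \<in> {1..r} then g j else j)" for j
  have "inj_on g {1..r}"
    using g disj by (intro inj_onI) (metis disjoint_family_onD disjoint_iff)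
  moreover have "g ` {1..r} \<subseteq> {1..r}"
    using g by blast
  ultimately have "bij_betw g {1..r} {1..r}"
    by (simp add: bij_betw_def endo_inj_surj)
  moreover have "bij_betw \<pi> {1..r} {1..r} \<longleftrightarrow> bij_betw g {1..r} {1..r}"
    by (rule bij_betw_cong) (simp add: \<pi>_def)
  ultimately have "\<pi> permutes {1..r}"
    by (intro bij_imp_permutes) (auto simp: \<pi>_def)
  moreover have "\<pi> j = k" if "j \<in> {1..r}" "k \<in> {1..r}" "x k \<in> A j" for j k
    using g that by (simp add: \<pi>_def)
  ultimately show thesis using that by blast
qed

theorem theorem1p3:
  fixes r N :: nat
  assumes "N \<ge> 1" and "2 \<le> r" and "r \<le> CARD('d::finite) + 1"
  shows "\<exists>X :: nat \<Rightarrow> (real ^ 'd) set. color_classes N r X \<and>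
    (\<forall>A. colorful_partition N r X A \<longrightarrow>
      (\<exists>S \<subseteq> {1..N}. real (card S) \<le> fixed_point_prob r * real N \<and>
        \<not> hulls_intersect r (remove_classes X S A)))"
proof -
  have dim: "r \<le> DIM(real ^ 'd) + 1" using assms(3) by simp
  obtain p f :: "nat \<Rightarrow> real ^ 'd" and c where inj: "inj_on p {1..r}"
    and norm_p: "\<forall>k\<in>{1..r}. norm (p k) = 1"
    and halfspace: "\<forall>t\<ge>1. \<forall>k\<in>{1..r}. \<forall>m\<in>{1..r} - {k}. f k \<bullet> (t *\<^sub>R p m) \<le> c k"
    and empty: "\<forall>z. \<exists>k\<in>{1..r}. c k < f k \<bullet> z"
    by (rule ex_halfspaces_and_rays[OF assms(2) dim], rule that)
  \<comment> \<open>Class \<open>i\<close> lies on the sphere of radius \<open>i\<close>, so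
    distinct classes are disjoint, and \<open>i \<ge> 1\<close> meets the condition
    \<open>t \<ge> 1\<close> of the half-spaces.\<close>
  define X where "X i = (\<lambda>k. real i *\<^sub>R p k) ` {1..r}" for i
  have inj_x: "inj_on (\<lambda>k. real i *\<^sub>R p k) {1..r}" if "i \<in> {1..N}" for i
  proof (rule inj_onI)
    fix k m assume km: "k \<in> {1..r}" "m \<in> {1..r}" "real i *\<^sub>R p k = real i *\<^sub>R p m"
    have "real i \<noteq> 0" using that by simp
    with km(3) have "p k = p m" by (metis scaleR_left_imp_eq)
    with inj km(1,2) show "k = m" by (meson inj_onD)
  qed
  have norm_X: "norm y = real i" if "y \<in> X i" for y i
    using that norm_p by (auto simp: X_def)
  have "color_classes N r X"
    unfolding color_classes_def
  proof (intro conjI ballI)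
    show "finite (X i)" for i by (simp add: X_def)
    show "card (X i) = r" if "i \<in> {1..N}" for i
      using card_image[OF inj_x[OF that]] by (simp add: X_def)
    show "disjoint_family_on X {1..N}"
      unfolding disjoint_family_on_def
      by (metis disjoint_iff norm_X of_nat_eq_iff)
  qed
  moreover have "\<exists>S \<subseteq> {1..N}. real (card S) \<le> fixed_point_prob r * real N \<and>
        \<not> hulls_intersect r (remove_classes X S A)" if part: "colorful_partition N r X A" for A
  proof -
    have "\<forall>i\<in>{1..N}. \<exists>\<pi>. \<pi> permutes {1..r} \<and>
        (\<forall>j\<in>{1..r}. \<forall>k\<in>{1..r}. real i *\<^sub>R p k \<in> A j \<longrightarrow> \<pi> j = k)"
    proof
      fix i assume i: "i \<in> {1..N}"
      show "\<exists>\<pi>. \<pi> permutes {1..r} \<and>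
        (\<forall>j\<in>{1..r}. \<forall>k\<in>{1..r}. real i *\<^sub>R p k \<in> A j \<longrightarrow> \<pi> j = k)"
        using colorful_partition_permutation[OF part i X_def inj_x[OF i]] by metis
    qed
    from bchoice[OF this] obtain \<pi> where \<pi>: "\<forall>i\<in>{1..N}. \<pi> i permutes {1..r} \<and>
        (\<forall>j\<in>{1..r}. \<forall>k\<in>{1..r}. real i *\<^sub>R p k \<in> A j \<longrightarrow> \<pi> i j = k)" ..
    then have perm: "\<pi> i permutes {1..r}" if "i \<in> {1..N}" for i
      using that by blast
    obtain \<sigma> where \<sigma>: "\<sigma> permutes {1..r}"
      and few: "real (card {i\<in>{1..N}. \<exists>j\<in>{1..r}. \<pi> i j = \<sigma> j}) \<le>
        fixed_point_prob r * real (card {1..N})"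
      using ex_permutation_few_agreements[of "{1..N}" \<pi> r, OF finite_atLeastAtMost perm] by blast
    define S where "S = {i\<in>{1..N}. \<exists>j\<in>{1..r}. \<pi> i j = \<sigma> j}"
    have hull: "convex hull (remove_classes X S A j) \<subseteq> {z. f (\<sigma> j) \<bullet> z \<le> c (\<sigma> j)}"
      if j: "j \<in> {1..r}" for j
    proof (rule hull_minimal)
      show "remove_classes X S A j \<subseteq> {z. f (\<sigma> j) \<bullet> z \<le> c (\<sigma> j)}"
      proof
        fix y assume y: "y \<in> remove_classes X S A j"
        then have "y \<in> (\<Union>i\<in>{1..N}. X i)"
          using part j by (auto simp: remove_classes_def colorful_partition_def)
        then obtain i k where ik: "i \<in> {1..N}" "k \<in> {1..r}" "y = real i *\<^sub>R p k"
          by (auto simp: X_def)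
        have "i \<notin> S" "y \<in> A j"
          using y ik by (auto simp: remove_classes_def X_def)
        \<comment> \<open>The point \<open>y\<close> in \<open>A j\<close> forces
          \<open>\<pi> i j = k\<close>, whereas \<open>i \<notin> S\<close> excludes
          \<open>\<pi> i j = \<sigma> j\<close>.\<close>
        then have "k \<noteq> \<sigma> j"
          using \<pi> ik j unfolding S_def by blast
        moreover have "\<sigma> j \<in> {1..r}"
          using permutes_in_image[OF \<sigma>] j by blast
        ultimately show "y \<in> {z. f (\<sigma> j) \<bullet> z \<le> c (\<sigma> j)}"
          using halfspace ik by simp
      qed
    qed (rule convex_halfspace_le)
    have "\<not> hulls_intersect r (remove_classes X S A)"
    proof
      assume "hulls_intersect r (remove_classes X S A)"
      then obtain z where z: "z \<in> (\<Inter>j\<in>{1..r}. convex hull (remove_classes X S A j))"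
        unfolding hulls_intersect_def by blast
      obtain k where k: "k \<in> {1..r}" "c k < f k \<bullet> z"
        using empty by blast
      \<comment> \<open>Surjectivity of \<open>\<sigma>\<close> assigns every half-space to some
        part, including the one that \<open>z\<close> violates.\<close>
      have "k \<in> \<sigma> ` {1..r}"
        using k(1) by (simp only: permutes_image[OF \<sigma>])
      then obtain j where j: "j \<in> {1..r}" "\<sigma> j = k" by blast
      then have "f k \<bullet> z \<le> c k" using hull[OF j(1)] z by blast
      with k(2) show False by simp
    qed
    moreover have "S \<subseteq> {1..N}" by (auto simp: S_def)
    moreover have "real (card S) \<le> fixed_point_prob r * real N"
      using few by (simp add: S_def)
    ultimately show ?thesis by blast
  qed
  ultimately show ?thesis by blast
qed

end
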